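(* Let $V$ be a compact length space and let $f\colon V\to\mathbb{R}$ be a continuous function. Then the limit $\lim_{\epsilon\downarrow0}c_f(\epsilon)$ exists (as a real number).
   Context: A compact length space is a compact metric space $(V,d)$ such that for all $x,y\in V$ the distance $d(x,y)$ is the infimum of the lengths of rectifiable paths between $x$ and $y$. Put $B(x,\epsilon)=\{y\in V:d(x,y)\le\epsilon\}$. For $\epsilon>0$, the $\epsilon$-adjacency graph of $V$ has vertex set $V$, with $x,y$ connected if and only if $d(x,y)\le\epsilon$. For $\epsilon>0$ and continuous $f,u_0\colon V\to\mathbb{R}$, the game values on the $\epsilon$-adjacency graph with terminal payoff $u_0$ and running payoff $f$ are the functions $(u_n)_{n\ge0}$ starting from $u_0$ with $$u_{n+1}(x)=\frac12\Big(\min_{B(x,\epsilon)}u_n+\max_{B(x,\epsilon)}u_n\Big)+f(x),\qquad x\in V,\ n\ge 0.$$ $c_f(\epsilon)$ (Player I's long term advantage) is the unique real constant $c$ such that, for such game values with any terminal payoff $u_0$, the sequence of functions $(u_n-nc)_{n\ge 0}$ is uniformly bounded (such a constant exists and does not depend on $u_0$). *)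

theory Defs
  imports "HOL-Analysis.Analysis"
begin

text \<open>
  Lengths of the polygonal chains inscribed in \<open>g\<close> along subdivisions
  \<open>0 = t 0 \<le> t 1 \<le> \<dots> \<le> t n = 1\<close> of the unit interval.
\<close>
definition chain_lengths :: "(real \<Rightarrow> 'a::metric_space) \<Rightarrow> real set" where
  "chain_lengths g =
     {\<Sum>i<n. dist (g (t i)) (g (t (Suc i))) |n t.
        t 0 = 0 \<and> t n = 1 \<and> mono_on {..n::nat} t}"

definition rectifiable_path :: "(real \<Rightarrow> 'a::metric_space) \<Rightarrow> bool" where
  "rectifiable_path g \<longleftrightarrow> path g \<and> bdd_above (chain_lengths g)"

definition path_length :: "(real \<Rightarrow> 'a::metric_space) \<Rightarrow> real" where
  "path_length g = Sup (chain_lengths g)"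

definition connecting_lengths :: "'a::metric_space set \<Rightarrow> 'a \<Rightarrow> 'a \<Rightarrow> real set" where
  "connecting_lengths V x y =
     {path_length g |g. rectifiable_path g \<and> path_image g \<subseteq> V \<and>
        pathstart g = x \<and> pathfinish g = y}"

text \<open>
  The infimum of the empty set of lengths is infinite, but \<^term>\<open>Inf {} :: real\<close> is not;
  hence the explicit requirement that rectifiable connecting paths exist.
\<close>
definition compact_length_space :: "'a::metric_space set \<Rightarrow> bool" where
  "compact_length_space V \<longleftrightarrow> compact V \<and>
     (\<forall>x\<in>V. \<forall>y\<in>V. connecting_lengths V x y \<noteq> {} \<and> dist x y = Inf (connecting_lengths V x y))"

text \<open>
  The infimum and supremum below are a minimum and a maximum: see the lemmas
  \<open>game_value_min\<close> and \<open>game_value_max\<close>.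
\<close>
primrec game_value ::
  "'a::metric_space set \<Rightarrow> real \<Rightarrow> ('a \<Rightarrow> real) \<Rightarrow> ('a \<Rightarrow> real) \<Rightarrow> nat \<Rightarrow> 'a \<Rightarrow> real" where
  "game_value V \<epsilon> f u0 0 = u0"
| "game_value V \<epsilon> f u0 (Suc n) = (\<lambda>x.
     ((INF y\<in>cball x \<epsilon> \<inter> V. game_value V \<epsilon> f u0 n y) +
      (SUP y\<in>cball x \<epsilon> \<inter> V. game_value V \<epsilon> f u0 n y)) / 2 + f x)"

definition long_term_advantage :: "'a::metric_space set \<Rightarrow> ('a \<Rightarrow> real) \<Rightarrow> real \<Rightarrow> real" where
  "long_term_advantage V f \<epsilon> =
     (THE c. \<forall>u0. continuous_on V u0 \<longrightarrow>
        (\<exists>K. \<forall>n. \<forall>x\<in>V. \<bar>game_value V \<epsilon> f u0 n x - real n * c\<bar> \<le> K))"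

lemma two_chords_le_path_length:
  assumes "rectifiable_path g" "s \<in> {0..1}"
  shows "dist (g 0) (g s) + dist (g s) (g 1) \<le> path_length g"
proof -
  define t :: "nat \<Rightarrow> real" where "t = (\<lambda>i. if i = 0 then 0 else if i = 1 then s else 1)"
  have "mono_on {..2} t"
    using assms(2) by (auto simp: mono_on_def t_def)
  moreover have "t 0 = 0" "t 2 = 1"
    by (auto simp: t_def)
  ultimately have "(\<Sum>i<2. dist (g (t i)) (g (t (Suc i)))) \<in> chain_lengths g"
    unfolding chain_lengths_def by blast
  moreover have "(\<Sum>i<2. dist (g (t i)) (g (t (Suc i)))) = dist (g 0) (g s) + dist (g s) (g 1)"
    by (simp add: t_def numeral_2_eq_2)
  ultimately show ?thesis
    using assms(1) unfolding path_length_def rectifiable_path_def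
    by (metis cSup_upper)
qed

lemma length_space_ball_shift:
  assumes V: "compact_length_space V" and "x \<in> V" "x' \<in> V" "y \<in> V"
    and "0 \<le> \<epsilon>" "dist x y \<le> \<epsilon>" "dist x x' < \<delta>"
  obtains y' where "y' \<in> V" "dist x' y' \<le> \<epsilon>" "dist y y' < \<delta>"
proof (cases "dist x' y \<le> \<epsilon>")
  case True
  with assms that[of y] show ?thesis
    using zero_le_dist[of x x'] by (simp add: le_less_trans)
next
  case False
  have "dist x' y < \<epsilon> + \<delta>"
    using assms dist_triangle[of x' y x] by (simp add: dist_commute)
  moreover have "connecting_lengths V x' y \<noteq> {}" "dist x' y = Inf (connecting_lengths V x' y)"
    using V \<open>x' \<in> V\<close> \<open>y \<in> V\<close> unfolding compact_length_space_def by auto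
  ultimately obtain l where "l \<in> connecting_lengths V x' y" "l < \<epsilon> + \<delta>"
    using cInf_lessD by metis
  then obtain g where g: "rectifiable_path g" "path_image g \<subseteq> V" "g 0 = x'" "g 1 = y"
    "path_length g < \<epsilon> + \<delta>"
    unfolding connecting_lengths_def pathstart_def pathfinish_def by auto
  have "continuous_on {0..1} (\<lambda>s. dist x' (g s))"
    using g(1) unfolding rectifiable_path_def path_def by (intro continuous_intros) auto
  then obtain s where s: "0 \<le> s" "s \<le> 1" "dist x' (g s) = \<epsilon>"
    using IVT'[of "\<lambda>s. dist x' (g s)" 0 \<epsilon> 1] g False \<open>0 \<le> \<epsilon>\<close> by auto
  have "dist x' (g s) + dist (g s) y \<le> path_length g"
    using two_chords_le_path_length[OF g(1), of s] s g by auto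
  then have "dist y (g s) < \<delta>"
    using s g by (simp add: dist_commute)
  moreover have "g s \<in> V"
    using g(2) s by (auto simp: path_image_def)
  ultimately show ?thesis
    using that s by auto
qed

lemma ball_extrema_attained:
  fixes u :: "'a::metric_space \<Rightarrow> real"
  assumes "compact V" "continuous_on V u" "x \<in> V" "0 \<le> \<epsilon>"
  shows "\<exists>y\<in>cball x \<epsilon> \<inter> V. u y = (INF z\<in>cball x \<epsilon> \<inter> V. u z) \<and> (\<forall>z\<in>cball x \<epsilon> \<inter> V. u y \<le> u z)"
    and "\<exists>y\<in>cball x \<epsilon> \<inter> V. u y = (SUP z\<in>cball x \<epsilon> \<inter> V. u z) \<and> (\<forall>z\<in>cball x \<epsilon> \<inter> V. u z \<le> u y)"
proof -
  have c: "compact (cball x \<epsilon> \<inter> V)"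
    using assms(1) by (simp add: closed_Int_compact)
  have n: "cball x \<epsilon> \<inter> V \<noteq> {}"
    using assms(3,4) mem_cball[of x x \<epsilon>] by (metis IntI dist_self empty_iff)
  have u: "continuous_on (cball x \<epsilon> \<inter> V) u"
    using assms(2) continuous_on_subset by blast
  obtain y where y: "y \<in> cball x \<epsilon> \<inter> V" "\<forall>z\<in>cball x \<epsilon> \<inter> V. u y \<le> u z"
    using continuous_attains_inf[OF c n u] by blast
  then have "(INF z\<in>cball x \<epsilon> \<inter> V. u z) = u y"
    by (intro cInf_eq_minimum) auto
  with y show "\<exists>y\<in>cball x \<epsilon> \<inter> V. u y = (INF z\<in>cball x \<epsilon> \<inter> V. u z) \<and> (\<forall>z\<in>cball x \<epsilon> \<inter> V. u y \<le> u z)"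
    by metis
  obtain y where y: "y \<in> cball x \<epsilon> \<inter> V" "\<forall>z\<in>cball x \<epsilon> \<inter> V. u z \<le> u y"
    using continuous_attains_sup[OF c n u] by blast
  then have "(SUP z\<in>cball x \<epsilon> \<inter> V. u z) = u y"
    by (intro cSup_eq_maximum) auto
  with y show "\<exists>y\<in>cball x \<epsilon> \<inter> V. u y = (SUP z\<in>cball x \<epsilon> \<inter> V. u z) \<and> (\<forall>z\<in>cball x \<epsilon> \<inter> V. u z \<le> u y)"
    by metis
qed

lemma continuous_on_ball_extrema:
  fixes u :: "'a::metric_space \<Rightarrow> real"
  assumes V: "compact_length_space V" and u: "continuous_on V u" and "0 \<le> \<epsilon>"
  shows "continuous_on V (\<lambda>x. INF y\<in>cball x \<epsilon> \<inter> V. u y)"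
    and "continuous_on V (\<lambda>x. SUP y\<in>cball x \<epsilon> \<inter> V. u y)"
proof -
  let ?m = "\<lambda>x. INF y\<in>cball x \<epsilon> \<inter> V. u y" and ?M = "\<lambda>x. SUP y\<in>cball x \<epsilon> \<inter> V. u y"
  have V': "compact V"
    using V by (simp add: compact_length_space_def)
  note att = ball_extrema_attained[OF V' u _ \<open>0 \<le> \<epsilon>\<close>]
  have key: "\<exists>\<delta>>0. \<forall>x\<in>V. \<forall>x'\<in>V. dist x x' < \<delta> \<longrightarrow> ?m x' < ?m x + e \<and> ?M x < ?M x' + e"
    if "e > 0" for e
  proof -
    obtain \<delta> where "\<delta> > 0" and \<delta>: "\<And>y y'. y \<in> V \<Longrightarrow> y' \<in> V \<Longrightarrow> dist y y' < \<delta> \<Longrightarrow> \<bar>u y - u y'\<bar> < e"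
      using compact_uniformly_continuous[OF u V'] \<open>e > 0\<close>
      unfolding uniformly_continuous_on_def dist_real_def
      by (metis dist_commute)
    have "?m x' < ?m x + e" "?M x < ?M x' + e" if x: "x \<in> V" "x' \<in> V" "dist x x' < \<delta>" for x x'
    proof -
      obtain y where y: "y \<in> V" "dist x y \<le> \<epsilon>" "u y = ?m x"
        using att(1)[OF x(1)] by auto
      obtain y' where y': "y' \<in> V" "dist x' y' \<le> \<epsilon>" "dist y y' < \<delta>"
        using length_space_ball_shift[OF V x(1,2) y(1) \<open>0 \<le> \<epsilon>\<close> y(2) x(3)] .
      have "?m x' \<le> u y'"
        using att(1)[OF x(2)] y' by (metis IntI mem_cball)
      with \<delta>[OF y(1) y'(1,3)] y(3) show "?m x' < ?m x + e"
        by linarith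
    next
      obtain y where y: "y \<in> V" "dist x y \<le> \<epsilon>" "u y = ?M x"
        using att(2)[OF x(1)] by auto
      obtain y' where y': "y' \<in> V" "dist x' y' \<le> \<epsilon>" "dist y y' < \<delta>"
        using length_space_ball_shift[OF V x(1,2) y(1) \<open>0 \<le> \<epsilon>\<close> y(2) x(3)] .
      have "u y' \<le> ?M x'"
        using att(2)[OF x(2)] y' by (metis IntI mem_cball)
      with \<delta>[OF y(1) y'(1,3)] y(3) show "?M x < ?M x' + e"
        by linarith
    qed
    with \<open>\<delta> > 0\<close> show ?thesis
      by blast
  qed
  have "\<exists>\<delta>>0. \<forall>x'\<in>V. dist x' x < \<delta> \<longrightarrow> \<bar>?m x' - ?m x\<bar> < e \<and> \<bar>?M x' - ?M x\<bar> < e"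
    if "x \<in> V" "e > 0" for x e
  proof -
    obtain \<delta> where "\<delta> > 0"
      and \<delta>: "\<And>x x'. x \<in> V \<Longrightarrow> x' \<in> V \<Longrightarrow> dist x x' < \<delta> \<Longrightarrow> ?m x' < ?m x + e \<and> ?M x < ?M x' + e"
      using key[OF \<open>e > 0\<close>] by blast
    have "\<bar>?m x' - ?m x\<bar> < e \<and> \<bar>?M x' - ?M x\<bar> < e" if "x' \<in> V" "dist x' x < \<delta>" for x'
      using \<delta>[of x x'] \<delta>[of x' x] that \<open>x \<in> V\<close> by (simp add: dist_commute abs_less_iff)
    with \<open>\<delta> > 0\<close> show ?thesis
      by blast
  qed
  then show "continuous_on V ?m" "continuous_on V ?M"
    unfolding continuous_on_iff dist_real_def by meson+
qed

lemma continuous_on_game_value: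
  assumes "compact_length_space V" "continuous_on V f" "continuous_on V u0" "0 \<le> \<epsilon>"
  shows "continuous_on V (game_value V \<epsilon> f u0 n)"
proof (induction n)
  case 0
  then show ?case using assms by simp
next
  case (Suc n)
  show ?case
    using continuous_on_ball_extrema[OF assms(1) Suc assms(4)] assms(2)
    by (auto intro!: continuous_intros)
qed

lemma
  assumes "compact_length_space V" "continuous_on V f" "continuous_on V u0" "0 \<le> \<epsilon>" "x \<in> V"
  shows game_value_min:
      "\<exists>y\<in>cball x \<epsilon> \<inter> V. game_value V \<epsilon> f u0 n y = (INF z\<in>cball x \<epsilon> \<inter> V. game_value V \<epsilon> f u0 n z) \<and>
         (\<forall>z\<in>cball x \<epsilon> \<inter> V. game_value V \<epsilon> f u0 n y \<le> game_value V \<epsilon> f u0 n z)"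
    and game_value_max:
      "\<exists>y\<in>cball x \<epsilon> \<inter> V. game_value V \<epsilon> f u0 n y = (SUP z\<in>cball x \<epsilon> \<inter> V. game_value V \<epsilon> f u0 n z) \<and>
         (\<forall>z\<in>cball x \<epsilon> \<inter> V. game_value V \<epsilon> f u0 n z \<le> game_value V \<epsilon> f u0 n y)"
  using ball_extrema_attained[OF _ continuous_on_game_value[OF assms(1-4)] assms(5,4)] assms(1)
  by (simp_all add: compact_length_space_def)

end

theory Submission
  imports Defs
begin

text \<open>
  Write \<open>c(\<epsilon>)\<close> for the long term advantage and \<open>T u\<close> for one round of the game started from
  \<open>u\<close>. Since \<open>T\<close> is monotone and commutes with adding constants, \<open>u + a \<le> T u\<close> implies
  \<open>a \<le> c(\<epsilon>)\<close>; conversely every \<open>a < c(\<epsilon>)\<close> admits such a subsolution \<open>u\<close>. If \<open>u\<close> is one at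
  radius \<open>\<epsilon>\<close>, then the maxima of \<open>u\<close> over balls of radius \<open>(k - 1) \<epsilon>\<close>, divided by \<open>k\<^sup>2\<close>, form one
  at radius \<open>k \<epsilon>\<close>, up to the oscillation \<open>\<omega>\<close> of \<open>f\<close> on balls of radius \<open>2 k \<epsilon>\<close>. Together with
  the symmetry \<open>f \<mapsto> - f\<close> this gives \<open>\<bar>c(k \<epsilon>) - c(\<epsilon>)\<bar> \<le> \<omega>\<close>, hence \<open>c\<close> varies little along
  small radii with rational ratios. Finally \<open>c\<close> is continuous, because at each finite time \<open>n\<close> the
  value at time \<open>n\<close>, which is continuous in \<open>\<epsilon>\<close>, bounds \<open>n c(\<epsilon>)\<close> by its extrema over \<open>V\<close>.
\<close>

section \<open>Intermediate points in a length space\<close>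

text \<open>A path from \<open>x\<close> to \<open>y\<close> of length below
  \<open>a + b + e\<close> meets the sphere of radius \<open>a\<close> about \<open>x\<close> at a
  point within \<open>b + e\<close> of \<open>y\<close>. One point \<open>z\<close> serves every
  \<open>e\<close>, since by compactness the distance to \<open>y\<close> attains its minimum on the
  ball about \<open>x\<close>.\<close>

lemma length_space_split:
  assumes V: "compact_length_space V" and x: "x \<in> V" and y: "y \<in> V"
    and a: "0 \<le> a" and b: "0 \<le> b" and ab: "dist x y \<le> a + b"
  obtains z where "z \<in> V" "dist x z \<le> a" "dist z y \<le> b"
proof (cases "dist x y \<le> a")
  case True
  then show ?thesis using that[of y] y b by simp
next
  case False
  have c: "compact (cball x a \<inter> V)"
    using V by (simp add: closed_Int_compact compact_length_space_def)
  have n: "cball x a \<inter> V \<noteq> {}"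
    using x a mem_cball[of x x a] by (metis IntI dist_self empty_iff)
  obtain z where z: "z \<in> cball x a \<inter> V" "\<forall>z'\<in>cball x a \<inter> V. dist z y \<le> dist z' y"
    using continuous_attains_inf[OF c n continuous_on_dist[OF continuous_on_id continuous_on_const]]
    by blast
  have "dist z y \<le> b + e" if "e > 0" for e
  proof -
    have "connecting_lengths V x y \<noteq> {}" "Inf (connecting_lengths V x y) < a + b + e"
      using V x y ab \<open>e > 0\<close> unfolding compact_length_space_def by fastforce+
    then obtain l where "l \<in> connecting_lengths V x y" "l < a + b + e"
      using cInf_lessD by metis
    then obtain g where g: "rectifiable_path g" "path_image g \<subseteq> V" "g 0 = x" "g 1 = y"
      "path_length g < a + b + e"
      unfolding connecting_lengths_def pathstart_def pathfinish_def by auto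
    have "continuous_on {0..1} (\<lambda>s. dist x (g s))"
      using g(1) unfolding rectifiable_path_def path_def by (intro continuous_intros) auto
    then obtain s where s: "0 \<le> s" "s \<le> 1" "dist x (g s) = a"
      using IVT'[of "\<lambda>s. dist x (g s)" 0 a 1] g False a by auto
    have "dist x (g s) + dist (g s) y \<le> path_length g"
      using two_chords_le_path_length[OF g(1), of s] s g by auto
    moreover have "g s \<in> cball x a \<inter> V"
      using g(2) s by (auto simp: path_image_def)
    ultimately show ?thesis
      using z(2) s(3) g(5) by force
  qed
  then have "dist z y \<le> b"
    by (rule field_le_epsilon)
  with z that show ?thesis by auto
qed

section \<open>One round of the game\<close>

definition ball_sup :: "'a::metric_space set \<Rightarrow> real \<Rightarrow> ('a \<Rightarrow> real) \<Rightarrow> 'a \<Rightarrow> real" where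
  "ball_sup V \<epsilon> u x = (SUP y\<in>cball x \<epsilon> \<inter> V. u y)"

definition ball_inf :: "'a::metric_space set \<Rightarrow> real \<Rightarrow> ('a \<Rightarrow> real) \<Rightarrow> 'a \<Rightarrow> real" where
  "ball_inf V \<epsilon> u x = (INF y\<in>cball x \<epsilon> \<inter> V. u y)"

definition game_step ::
  "'a::metric_space set \<Rightarrow> real \<Rightarrow> ('a \<Rightarrow> real) \<Rightarrow> ('a \<Rightarrow> real) \<Rightarrow> 'a \<Rightarrow> real" where
  "game_step V \<epsilon> f u x = (ball_inf V \<epsilon> u x + ball_sup V \<epsilon> u x) / 2 + f x"

lemma game_value_Suc:
  "game_value V \<epsilon> f u0 (Suc n) = game_step V \<epsilon> f (game_value V \<epsilon> f u0 n)"
  by (simp add: fun_eq_iff game_step_def ball_inf_def ball_sup_def)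

declare game_value.simps(2) [simp del]

lemma game_value_add:
  "game_value V \<epsilon> f u0 (m + n) = game_value V \<epsilon> f (game_value V \<epsilon> f u0 m) n"
  by (induction n) (simp_all add: game_value_Suc)

text \<open>Negating both payoffs exchanges the players: minima and maxima trade places. This
  symmetry later turns one-sided estimates into two-sided ones.\<close>

lemma game_value_uminus:
  "game_value V \<epsilon> (\<lambda>x. - f x) (\<lambda>x. - u0 x) n x = - game_value V \<epsilon> f u0 n x"
proof (induction n arbitrary: x)
  case (Suc n)
  have "(INF y\<in>A. - h y) = - (SUP y\<in>A. h y)" "(SUP y\<in>A. - h y) = - (INF y\<in>A. h y)"
    for A :: "'a set" and h :: "'a \<Rightarrow> real"
    by (simp_all add: Inf_real_def image_image)
  with Suc show ?case by (simp add: game_value.simps(2) field_simps)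
qed simp

section \<open>Nearly additive and nearly convex sequences\<close>

lemma le_if_multiples_le:
  fixes a b K :: real
  assumes "\<And>n::nat. real n * a \<le> real n * b + K"
  shows "a \<le> b"
proof (rule ccontr)
  assume "\<not> a \<le> b"
  then obtain n where "K < real n * (a - b)"
    using reals_Archimedean3[of "a - b"] by auto
  with assms[of n] show False by (simp add: algebra_simps)
qed

text \<open>\<open>a + C\<close> is subadditive and \<open>a - C\<close> superadditive, so every
  quotient \<open>(a m - C) / m\<close> lies below every \<open>(a n + C) / n\<close>, and
  \<open>c\<close> is taken between the two families.\<close>

lemma quasi_additive_near_linear:
  fixes a :: "nat \<Rightarrow> real"
  assumes C: "\<And>m n. \<bar>a (m + n) - a m - a n\<bar> \<le> C"
  obtains c where "\<And>n. \<bar>a n - real n * c\<bar> \<le> C"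
proof -
  have step: "\<bar>a (Suc (Suc k) * n) - a (Suc k * n) - a n\<bar> \<le> C" for k n
    using C[of "Suc k * n" n] by (simp add: add.commute)
  have up: "a (Suc k * n) + C \<le> real (Suc k) * (a n + C)" for k n
  proof (induction k)
    case (Suc k)
    have "real (Suc (Suc k)) * (a n + C) = real (Suc k) * (a n + C) + (a n + C)"
      by (simp add: algebra_simps)
    with Suc step[of k n] show ?case by linarith
  qed simp
  have lo: "real (Suc k) * (a n - C) \<le> a (Suc k * n) - C" for k n
  proof (induction k)
    case (Suc k)
    have "real (Suc (Suc k)) * (a n - C) = real (Suc k) * (a n - C) + (a n - C)"
      by (simp add: algebra_simps)
    with Suc step[of k n] show ?case by linarith
  qed simp
  \<comment> \<open>Both quotients are compared through the index \<open>Suc m * Suc n\<close>; the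
    instance \<open>C[of 0 0]\<close> yields \<open>0 \<le> C\<close>.\<close>
  have key: "(a (Suc m) - C) / Suc m \<le> (a (Suc n) + C) / Suc n" for m n
  proof -
    have "real (Suc n) * (a (Suc m) - C) \<le> real (Suc m) * (a (Suc n) + C)"
      using up[of m "Suc n"] lo[of n "Suc m"] C[of 0 0] by (simp add: mult.commute)
    then show ?thesis by (simp add: field_simps)
  qed
  define c where "c = (INF n. (a (Suc n) + C) / Suc n)"
  have bdd: "bdd_below (range (\<lambda>n. (a (Suc n) + C) / Suc n))"
    using key[of 0] by (auto intro!: bdd_belowI)
  have "\<bar>a n - real n * c\<bar> \<le> C" for n
  proof (cases n)
    case 0
    then show ?thesis using C[of 0 0] by simp
  next
    case (Suc m)
    have "c \<le> (a (Suc m) + C) / Suc m"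
      unfolding c_def by (rule cINF_lower[OF bdd]) simp
    moreover have "(a (Suc m) - C) / Suc m \<le> c"
      unfolding c_def by (rule cINF_greatest) (use key in auto)
    ultimately show ?thesis
      by (simp add: Suc field_simps abs_le_iff)
  qed
  with that show thesis by blast
qed

text \<open>Adding the parabola \<open>G * j\<^sup>2\<close>, of second difference
  \<open>2 * G\<close>, makes \<open>2 * a\<close> convex up to index \<open>2 * k\<close>; the
  first \<open>k\<close> increments then sum to at most the next \<open>k\<close>.\<close>

lemma discrete_convexity_defect:
  fixes a :: "nat \<Rightarrow> real"
  assumes G: "\<And>j. j + 2 \<le> 2 * k \<Longrightarrow> 2 * a (Suc j) - a j - G \<le> a (Suc (Suc j))"
  shows "2 * a k - (real k)\<^sup>2 * G \<le> a (2 * k) + a 0"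
proof -
  define b where "b j = 2 * a j + G * (real j)\<^sup>2" for j
  have step: "b (Suc j) - b j \<le> b (Suc (Suc j)) - b (Suc j)" if "j + 2 \<le> 2 * k" for j
    using G[OF that] by (simp add: b_def power2_eq_square algebra_simps)
  have mono: "j + i < 2 * k \<Longrightarrow> b (Suc j) - b j \<le> b (Suc (j + i)) - b (j + i)" for i j
  proof (induction i)
    case (Suc i)
    then show ?case using step[of "j + i"] by simp
  qed simp
  have "(\<Sum>j<k. b (Suc j) - b j) \<le> (\<Sum>j<k. b (Suc (j + k)) - b (j + k))"
    by (intro sum_mono mono) auto
  moreover have "(\<Sum>j<k. b (Suc j) - b j) = b k - b 0"
    by (rule sum_lessThan_telescope)
  moreover have "(\<Sum>j<k. b (Suc (j + k)) - b (j + k)) = b (2 * k) - b k"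
    using sum_lessThan_telescope[of "\<lambda>j. b (j + k)" k] by (simp add: mult_2)
  ultimately have "2 * b k \<le> b (2 * k) + b 0" by simp
  then show ?thesis by (simp add: b_def power2_eq_square algebra_simps)
qed

section \<open>Attained extrema and comparison of rounds\<close>

text \<open>Nonemptiness makes the advantage unique: over the empty set every constant is
  admissible.\<close>

locale game_space =
  fixes V :: "'a::metric_space set"
  assumes V: "compact_length_space V" and nonempty: "V \<noteq> {}"
begin

lemma compact_V: "compact V"
  using V by (simp add: compact_length_space_def)

lemma continuous_ball_sup: "continuous_on V u \<Longrightarrow> 0 \<le> \<epsilon> \<Longrightarrow> continuous_on V (ball_sup V \<epsilon> u)"
  using continuous_on_ball_extrema(2)[OF V] unfolding ball_sup_def[abs_def] by blast

lemma ball_sup_upper: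
  assumes "continuous_on V u" "x \<in> V" "y \<in> V" "dist x y \<le> \<epsilon>"
  shows "u y \<le> ball_sup V \<epsilon> u x"
  using ball_extrema_attained(2)[OF compact_V assms(1,2), of \<epsilon>] assms order_trans[OF zero_le_dist]
  unfolding ball_sup_def by (metis IntI mem_cball)

lemma ball_inf_lower:
  assumes "continuous_on V u" "x \<in> V" "y \<in> V" "dist x y \<le> \<epsilon>"
  shows "ball_inf V \<epsilon> u x \<le> u y"
  using ball_extrema_attained(1)[OF compact_V assms(1,2), of \<epsilon>] assms order_trans[OF zero_le_dist]
  unfolding ball_inf_def by (metis IntI mem_cball)

lemma ball_sup_attained:
  assumes "continuous_on V u" "x \<in> V" "0 \<le> \<epsilon>"
  obtains y where "y \<in> V" "dist x y \<le> \<epsilon>" "ball_sup V \<epsilon> u x = u y"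
  using ball_extrema_attained(2)[OF compact_V assms] unfolding ball_sup_def by force

lemma ball_inf_attained:
  assumes "continuous_on V u" "x \<in> V" "0 \<le> \<epsilon>"
  obtains y where "y \<in> V" "dist x y \<le> \<epsilon>" "ball_inf V \<epsilon> u x = u y"
  using ball_extrema_attained(1)[OF compact_V assms] unfolding ball_inf_def by force

lemma bounded_on_V:
  fixes u :: "'a \<Rightarrow> real"
  assumes "continuous_on V u"
  obtains B where "0 \<le> B" "\<And>x. x \<in> V \<Longrightarrow> \<bar>u x\<bar> \<le> B"
proof -
  have "bounded (u ` V)"
    using compact_V assms by (simp add: compact_continuous_image compact_imp_bounded)
  then show thesis
    using that unfolding bounded_pos by (metis imageI less_imp_le real_norm_def)
qed

lemma game_step_ge:
  assumes "continuous_on V u" "x \<in> V" "y \<in> V" "dist x y \<le> \<epsilon>"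
    and l: "\<And>z. z \<in> V \<Longrightarrow> dist x z \<le> \<epsilon> \<Longrightarrow> l \<le> u z"
  shows "(l + u y) / 2 + f x \<le> game_step V \<epsilon> f u x"
proof -
  have "0 \<le> \<epsilon>" using assms(4) zero_le_dist[of x y] by linarith
  then obtain z where "z \<in> V" "dist x z \<le> \<epsilon>" "ball_inf V \<epsilon> u x = u z"
    using ball_inf_attained assms by metis
  with l[of z] ball_sup_upper[OF assms(1-4)] show ?thesis
    by (simp add: game_step_def)
qed

lemma game_step_le:
  assumes "continuous_on V u" "x \<in> V" "0 \<le> \<epsilon>" and B: "\<And>z. z \<in> V \<Longrightarrow> u z \<le> B"
  shows "game_step V \<epsilon> f u x \<le> B + f x"
proof -
  obtain y where "y \<in> V" "ball_sup V \<epsilon> u x = u y"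
    using ball_sup_attained[OF assms(1-3)] by metis
  moreover obtain z where "z \<in> V" "ball_inf V \<epsilon> u x = u z"
    using ball_inf_attained[OF assms(1-3)] by metis
  ultimately show ?thesis
    using B[of y] B[of z] unfolding game_step_def by argo
qed

text \<open>By splitting distances, each point of one ball about \<open>x\<close> is within
  \<open>\<bar>\<epsilon> - \<epsilon>'\<bar>\<close> of a point of the other. The maximizer of
  \<open>u\<close> and the minimizer of \<open>v\<close> are each moved into the other ball.\<close>

lemma game_step_diff_le:
  assumes u: "continuous_on V u" and v: "continuous_on V v" and x: "x \<in> V"
    and e: "0 \<le> \<epsilon>" "0 \<le> \<epsilon>'"
    and uv: "\<And>y z. y \<in> V \<Longrightarrow> z \<in> V \<Longrightarrow> dist y z \<le> \<bar>\<epsilon> - \<epsilon>'\<bar> \<Longrightarrow> u y \<le> v z + a"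
  shows "game_step V \<epsilon> f u x \<le> game_step V \<epsilon>' f v x + a"
proof -
  have near: "\<exists>z\<in>V. dist x z \<le> r' \<and> dist z y \<le> \<bar>r - r'\<bar>"
    if "y \<in> V" "dist x y \<le> r" "0 \<le> r'" for y r r'
    using that x length_space_split[OF V x \<open>y \<in> V\<close>, of r' "\<bar>r - r'\<bar>"] by force
  obtain y where y: "y \<in> V" "dist x y \<le> \<epsilon>" "ball_sup V \<epsilon> u x = u y"
    using ball_sup_attained[OF u x e(1)] .
  obtain z where "z \<in> V" "dist x z \<le> \<epsilon>'" "dist z y \<le> \<bar>\<epsilon> - \<epsilon>'\<bar>"
    using near[OF y(1,2) e(2)] by auto
  then have "ball_sup V \<epsilon> u x \<le> ball_sup V \<epsilon>' v x + a"
    using uv[of y z] y ball_sup_upper[OF v x, of z \<epsilon>'] by (simp add: dist_commute)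
  moreover
  obtain z where z: "z \<in> V" "dist x z \<le> \<epsilon>'" "ball_inf V \<epsilon>' v x = v z"
    using ball_inf_attained[OF v x e(2)] .
  obtain y where "y \<in> V" "dist x y \<le> \<epsilon>" "dist y z \<le> \<bar>\<epsilon> - \<epsilon>'\<bar>"
    using near[OF z(1,2) e(1)] by (auto simp: abs_minus_commute)
  then have "ball_inf V \<epsilon> u x \<le> ball_inf V \<epsilon>' v x + a"
    using uv[of y z] z ball_inf_lower[OF u x, of y \<epsilon>] by simp
  ultimately show ?thesis
    unfolding game_step_def by argo
qed

lemma game_step_mono:
  assumes "continuous_on V u" "continuous_on V v" "x \<in> V" "0 \<le> \<epsilon>"
    and "\<And>y. y \<in> V \<Longrightarrow> u y \<le> v y + a"
  shows "game_step V \<epsilon> f u x \<le> game_step V \<epsilon> f v x + a"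
  using assms by (intro game_step_diff_le) auto

section \<open>Iterated rounds\<close>

context
  fixes f :: "'a \<Rightarrow> real"
  assumes f: "continuous_on V f"
begin

lemma continuous_game_value:
  "continuous_on V u \<Longrightarrow> 0 \<le> \<epsilon> \<Longrightarrow> continuous_on V (game_value V \<epsilon> f u n)"
  using continuous_on_game_value[OF V f] .

lemma game_value_mono:
  assumes "continuous_on V u" "continuous_on V v" "0 \<le> \<epsilon>"
    and "\<And>y. y \<in> V \<Longrightarrow> u y \<le> v y + a" and "x \<in> V"
  shows "game_value V \<epsilon> f u n x \<le> game_value V \<epsilon> f v n x + a"
  using \<open>x \<in> V\<close>
proof (induction n arbitrary: x)
  case (Suc n)
  then show ?case
    unfolding game_value_Suc using assms
    by (intro game_step_mono continuous_game_value) auto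
qed (use assms in auto)

lemma game_value_subsolution:
  assumes u: "continuous_on V u" and "0 \<le> \<epsilon>" and x: "x \<in> V"
    and sub: "\<And>x. x \<in> V \<Longrightarrow> u x + a \<le> game_step V \<epsilon> f u x"
  shows "u x + real n * a \<le> game_value V \<epsilon> f u n x"
  using x
proof (induction n arbitrary: x)
  case (Suc n)
  have "u y \<le> game_value V \<epsilon> f u n y + - (real n * a)" if "y \<in> V" for y
    using Suc.IH[OF that] by simp
  then have "game_step V \<epsilon> f u x \<le> game_step V \<epsilon> f (game_value V \<epsilon> f u n) x + - (real n * a)"
    using Suc.prems assms by (intro game_step_mono u continuous_game_value)
  then show ?case
    using sub[OF Suc.prems] by (simp add: game_value_Suc algebra_simps)
qed simp

text \<open>Winning every toss, the maximizing player walks from \<open>x\<close> to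
  \<open>y\<close> in \<open>n\<close> moves of length at most \<open>\<epsilon>\<close>. This has
  weight \<open>1 / 2 ^ n\<close>; in all other cases the terminal payoff is still at least
  \<open>m\<close>. Running payoffs cost at most \<open>F\<close> per round.\<close>

lemma game_value_spread:
  assumes u: "continuous_on V u" and e: "0 < \<epsilon>"
    and F: "\<And>x. x \<in> V \<Longrightarrow> \<bar>f x\<bar> \<le> F" and m: "\<And>x. x \<in> V \<Longrightarrow> m \<le> u x"
    and "x \<in> V" "y \<in> V" "dist x y \<le> real n * \<epsilon>"
  shows "m - real n * F + (u y - m) / 2 ^ n \<le> game_value V \<epsilon> f u n x"
  using assms(5-)
proof (induction n arbitrary: x)
  case (Suc n)
  have low: "m - real n * F \<le> game_value V \<epsilon> f u n z" if "z \<in> V" for z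
    using that
  proof (induction n arbitrary: z)
    case (Suc n)
    have "(m - real n * F + game_value V \<epsilon> f u n z) / 2 + f z \<le> game_value V \<epsilon> f u (Suc n) z"
      unfolding game_value_Suc using Suc e
      by (intro game_step_ge continuous_game_value[OF u]) auto
    with F[OF Suc.prems] Suc.IH[OF Suc.prems] show ?case
      by (simp add: field_simps)
  qed (use m in auto)
  have "dist x y \<le> \<epsilon> + real n * \<epsilon>" using Suc.prems by (simp add: algebra_simps)
  then obtain z where z: "z \<in> V" "dist x z \<le> \<epsilon>" "dist z y \<le> real n * \<epsilon>"
    using length_space_split[OF V Suc.prems(1,2), of \<epsilon> "real n * \<epsilon>"] e by auto
  have "(m - real n * F + game_value V \<epsilon> f u n z) / 2 + f x \<le> game_value V \<epsilon> f u (Suc n) x"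
    unfolding game_value_Suc
    using z e Suc.prems low by (intro game_step_ge continuous_game_value[OF u]) auto
  moreover have "m - real n * F + (u y - m) / 2 ^ n \<le> game_value V \<epsilon> f u n z"
    using Suc z by blast
  moreover have "a - F + t / 2 \<le> G" if "(a + g) / 2 + h \<le> G" "a + t \<le> g" "- F \<le> h"
    for a g h t G :: real
    using that by argo
  moreover have "- F \<le> f x" using F[OF Suc.prems(1)] by simp
  ultimately have "m - real n * F - F + (u y - m) / 2 ^ n / 2 \<le> game_value V \<epsilon> f u (Suc n) x"
    by blast
  then show ?case
    by (simp add: distrib_left distrib_right diff_diff_eq add.commute mult.commute)
qed (use assms in auto)

section \<open>Bounded oscillation and existence of the advantage\<close>

lemma chain_count:
  assumes "0 < \<epsilon>"
  obtains N where "0 < N" "\<And>x y. x \<in> V \<Longrightarrow> y \<in> V \<Longrightarrow> dist x y \<le> real N * \<epsilon>"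
proof -
  have "bounded V" using compact_V by (rule compact_imp_bounded)
  then obtain B where B: "\<And>x y. x \<in> V \<Longrightarrow> y \<in> V \<Longrightarrow> dist x y \<le> B"
    using bounded_two_points by metis
  obtain N where "B < real N * \<epsilon>"
    using reals_Archimedean3[OF assms] by blast
  then have "dist x y \<le> real (Suc N) * \<epsilon>" if "x \<in> V" "y \<in> V" for x y
    using B[OF that] assms by (simp add: algebra_simps)
  with that[of "Suc N"] show thesis by blast
qed

lemma game_value_le:
  assumes "continuous_on V u" "0 \<le> \<epsilon>"
    and F: "\<And>x. x \<in> V \<Longrightarrow> \<bar>f x\<bar> \<le> F" and B: "\<And>x. x \<in> V \<Longrightarrow> u x \<le> B" and "x \<in> V"
  shows "game_value V \<epsilon> f u n x \<le> B + real n * F"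
  using \<open>x \<in> V\<close>
proof (induction n arbitrary: x)
  case (Suc n)
  have "game_value V \<epsilon> f u (Suc n) x \<le> B + real n * F + f x"
    unfolding game_value_Suc using assms Suc by (intro game_step_le continuous_game_value) auto
  with F[OF Suc.prems] show ?case by (simp add: algebra_simps)
qed (use B in auto)

text \<open>
  \<open>N\<close> rounds, enough to cross \<open>V\<close>, contract oscillations by the factor \<open>1 - 1 / 2 ^ N\<close>
  up to an additive error, so oscillations below the fixed point of this affine map stay below it.
\<close>

lemma oscillation_bounded:
  assumes e: "0 < \<epsilon>"
  obtains C where "\<And>n x y. x \<in> V \<Longrightarrow> y \<in> V \<Longrightarrow>
    game_value V \<epsilon> f (\<lambda>_. 0) n x - game_value V \<epsilon> f (\<lambda>_. 0) n y \<le> C"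
proof -
  let ?u = "game_value V \<epsilon> f (\<lambda>_. 0)"
  obtain F where F: "0 \<le> F" "\<And>x. x \<in> V \<Longrightarrow> \<bar>f x\<bar> \<le> F"
    using bounded_on_V[OF f] by blast
  obtain N where N: "0 < N" "\<And>x y. x \<in> V \<Longrightarrow> y \<in> V \<Longrightarrow> dist x y \<le> real N * \<epsilon>"
    using chain_count[OF e] by blast
  \<comment> \<open>The value at \<open>x\<close> is bounded by the maximum \<open>M\<close> plus
    the running payoffs, the value at \<open>y\<close> from below by the walk to
    \<open>z\<close>.\<close>
  have diff: "game_value V \<epsilon> f v n x - game_value V \<epsilon> f v n y
      \<le> (M - m) + 2 * real n * F - (v z - m) / 2 ^ n"
    if v: "continuous_on V v" and m: "\<And>x. x \<in> V \<Longrightarrow> m \<le> v x" and M: "\<And>x. x \<in> V \<Longrightarrow> v x \<le> M"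
      and xy: "x \<in> V" "y \<in> V" and z: "z \<in> V" "dist y z \<le> real n * \<epsilon>" for v m M n x y z
    using game_value_spread[OF v e F(2) m xy(2) z] game_value_le[OF v _ F(2) M xy(1), of \<epsilon> n] e
    by simp
  \<comment> \<open>The fixed point of
    \<open>t \<mapsto> t * (1 - 1 / 2 ^ N) + 2 * N * F\<close>.\<close>
  define C where "C = 2 * real N * F * 2 ^ N"
  have small: "2 * real n * F \<le> C" if "n \<le> N" for n
  proof -
    have "2 * real n * F * 1 \<le> 2 * real N * F * 2 ^ N"
      using that F(1) by (intro mult_mono) auto
    then show ?thesis by (simp add: C_def)
  qed
  have "?u n x - ?u n y \<le> C" if "x \<in> V" "y \<in> V" for n x y
    using that
  proof (induction n arbitrary: x y rule: less_induct)
    case (less n)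
    show ?case
    proof (cases "n < N")
      \<comment> \<open>Too few rounds to cross \<open>V\<close>, but with zero terminal payoff only
        the running payoffs count.\<close>
      case True
      have "?u n x - ?u n y \<le> 2 * real n * F"
        using diff[of "\<lambda>_. 0" 0 0 x y y n] less.prems e by simp
      with small[of n] True show ?thesis by simp
    next
      case False
      \<comment> \<open>The last \<open>N\<close> iterations start from \<open>v\<close>, whose
        oscillation is at most \<open>C\<close> by induction, as \<open>0 < N\<close>.\<close>
      define v where "v = ?u (n - N)"
      have v: "continuous_on V v"
        using e by (auto simp: v_def intro: continuous_game_value)
      obtain p where p: "p \<in> V" "\<And>z. z \<in> V \<Longrightarrow> v p \<le> v z"
        using continuous_attains_inf[OF compact_V nonempty v] by blast
      obtain q where q: "q \<in> V" "\<And>z. z \<in> V \<Longrightarrow> v z \<le> v q"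
        using continuous_attains_sup[OF compact_V nonempty v] by blast
      have "?u n = game_value V \<epsilon> f v N"
        using game_value_add[of V \<epsilon> f "\<lambda>_. 0" "n - N" N] False by (simp add: v_def)
      then have "?u n x - ?u n y \<le> (v q - v p) + 2 * real N * F - (v q - v p) / 2 ^ N"
        using diff[OF v p(2) q(2) less.prems q(1) N(2)] less.prems q by simp
      also have "\<dots> = (v q - v p) * (1 - 1 / 2 ^ N) + C / 2 ^ N"
        by (simp add: C_def algebra_simps)
      also have "\<dots> \<le> C * (1 - 1 / 2 ^ N) + C / 2 ^ N"
        using less.IH[of "n - N" q p] q(1) p(1) False N(1)
        by (intro add_right_mono mult_right_mono) (auto simp: v_def)
      also have "\<dots> = C" by (simp add: algebra_simps)
      finally show ?thesis .
    qed
  qed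
  with that show thesis by blast
qed

text \<open>For zero terminal payoff, the function at time \<open>m\<close> is within
  \<open>C\<close> of its value at \<open>p\<close>. Restarting from that constant shows that the
  values at \<open>p\<close> are additive in time up to \<open>C\<close>, hence nearly linear.
  Another terminal payoff shifts all values by at most its bound \<open>B\<close>.\<close>

lemma long_term_advantage_exists:
  assumes e: "0 < \<epsilon>"
  obtains c where "\<And>u0. continuous_on V u0 \<Longrightarrow>
    \<exists>K. \<forall>n. \<forall>x\<in>V. \<bar>game_value V \<epsilon> f u0 n x - real n * c\<bar> \<le> K"
proof -
  let ?u = "game_value V \<epsilon> f (\<lambda>_. 0)"
  have e0: "0 \<le> \<epsilon>" using e by simp
  obtain C where C: "\<And>n x y. x \<in> V \<Longrightarrow> y \<in> V \<Longrightarrow> ?u n x - ?u n y \<le> C"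
    using oscillation_bounded[OF e] by blast
  obtain p where p: "p \<in> V" using nonempty by blast
  note cont = continuous_game_value[OF _ e0]
  have "\<bar>?u (m + n) p - ?u m p - ?u n p\<bar> \<le> C" for m n
  proof -
    have "?u (m + n) p \<le> ?u n p + (?u m p + C)"
      unfolding game_value_add using C[OF _ p] p e0
      by (intro game_value_mono cont) (auto simp: algebra_simps)
    moreover have "?u n p \<le> ?u (m + n) p + (C - ?u m p)"
      unfolding game_value_add using C[OF p] p e0
      by (intro game_value_mono cont) (auto simp: algebra_simps)
    ultimately show ?thesis by simp
  qed
  then obtain c where c: "\<And>n. \<bar>?u n p - real n * c\<bar> \<le> C"
    using quasi_additive_near_linear[of "\<lambda>n. ?u n p" C] by blast
  have "\<exists>K. \<forall>n. \<forall>x\<in>V. \<bar>game_value V \<epsilon> f u0 n x - real n * c\<bar> \<le> K"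
    if u0: "continuous_on V u0" for u0
  proof -
    obtain B where B: "\<And>x. x \<in> V \<Longrightarrow> \<bar>u0 x\<bar> \<le> B"
      using bounded_on_V[OF u0] by blast
    have "\<bar>game_value V \<epsilon> f u0 n x - real n * c\<bar> \<le> B + C + C" if x: "x \<in> V" for n x
    proof -
      have B': "u0 y \<le> 0 + B" "0 \<le> u0 y + B" if "y \<in> V" for y
        using B[OF that] by simp_all
      have "game_value V \<epsilon> f u0 n x \<le> ?u n x + B"
        using B' x e0 by (intro game_value_mono u0) auto
      moreover have "?u n x \<le> game_value V \<epsilon> f u0 n x + B"
        using B' x e0 by (intro game_value_mono u0) auto
      ultimately show ?thesis
        using c[of n] C[OF x p, of n] C[OF p x, of n] by linarith
    qed
    then show ?thesis by blast
  qed
  with that show thesis by blast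
qed

text \<open>Two admissible constants agree because \<open>n\<close> times their difference stays
  bounded; this resolves the definite description.\<close>

lemma long_term_advantage_eqI:
  assumes c: "\<And>u0. continuous_on V u0 \<Longrightarrow>
    \<exists>K. \<forall>n. \<forall>x\<in>V. \<bar>game_value V \<epsilon> f u0 n x - real n * c\<bar> \<le> K"
  shows "long_term_advantage V f \<epsilon> = c"
  unfolding long_term_advantage_def
proof (rule the_equality)
  fix d assume d: "\<forall>u0. continuous_on V u0 \<longrightarrow>
    (\<exists>K. \<forall>n. \<forall>x\<in>V. \<bar>game_value V \<epsilon> f u0 n x - real n * d\<bar> \<le> K)"
  obtain p where p: "p \<in> V" using nonempty by blast
  obtain K where K: "\<And>n. \<bar>game_value V \<epsilon> f (\<lambda>_. 0) n p - real n * c\<bar> \<le> K"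
    using c[of "\<lambda>_. 0"] p by auto
  obtain L where L: "\<And>n. \<bar>game_value V \<epsilon> f (\<lambda>_. 0) n p - real n * d\<bar> \<le> L"
    using d p by (metis continuous_on_const)
  have "real n * c \<le> real n * d + (K + L)" "real n * d \<le> real n * c + (K + L)" for n
    using K[of n] L[of n] by linarith+
  then show "d = c"
    using le_if_multiples_le by (metis order_antisym)
qed (use c in blast)

lemma long_term_advantage_bounded:
  assumes "0 < \<epsilon>" "continuous_on V u0"
  obtains K where "\<And>n x. x \<in> V \<Longrightarrow>
    \<bar>game_value V \<epsilon> f u0 n x - real n * long_term_advantage V f \<epsilon>\<bar> \<le> K"
  using long_term_advantage_exists[OF assms(1)] long_term_advantage_eqI assms(2) by metis

section \<open>Subsolutions and finite-time bounds\<close>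

text \<open>Values started from \<open>u\<close> grow by at least \<open>a\<close> per round, yet
  stay at bounded distance from \<open>n\<close> times the advantage.\<close>

lemma subsolution_le_advantage:
  assumes e: "0 < \<epsilon>" and u: "continuous_on V u"
    and sub: "\<And>x. x \<in> V \<Longrightarrow> u x + a \<le> game_step V \<epsilon> f u x"
  shows "a \<le> long_term_advantage V f \<epsilon>"
proof -
  obtain p where p: "p \<in> V" using nonempty by blast
  obtain K where K: "\<And>n. \<bar>game_value V \<epsilon> f u n p - real n * long_term_advantage V f \<epsilon>\<bar> \<le> K"
    using long_term_advantage_bounded[OF e u] p by metis
  have "real n * a \<le> real n * long_term_advantage V f \<epsilon> + (K - u p)" for n
    using game_value_subsolution[OF u less_imp_le[OF e] p sub, of n] K[of n] by linarith
  then show ?thesis by (rule le_if_multiples_le)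
qed

text \<open>Restarting after each block of \<open>n\<close> rounds, monotonicity lets the bound
  \<open>n * b\<close> accumulate to \<open>k * n * b\<close> after \<open>k\<close> blocks. Thus a
  single finite time controls the advantage.\<close>

lemma advantage_le:
  assumes e: "0 < \<epsilon>" and n: "0 < n"
    and b: "\<And>x. x \<in> V \<Longrightarrow> game_value V \<epsilon> f (\<lambda>_. 0) n x \<le> real n * b"
  shows "long_term_advantage V f \<epsilon> \<le> b"
proof -
  let ?u = "game_value V \<epsilon> f (\<lambda>_. 0)"
  obtain p where p: "p \<in> V" using nonempty by blast
  obtain K where K: "\<And>n. \<bar>?u n p - real n * long_term_advantage V f \<epsilon>\<bar> \<le> K"
    using long_term_advantage_bounded[OF e, of "\<lambda>_. 0"] p by (metis continuous_on_const)
  have le: "?u (k * n) x \<le> real k * (real n * b)" if "x \<in> V" for k x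
    using that
  proof (induction k arbitrary: x)
    case (Suc k)
    have "?u (k * n + n) x \<le> ?u n x + real k * (real n * b)"
      unfolding game_value_add using Suc e
      by (intro game_value_mono continuous_game_value) auto
    with b[OF Suc.prems] show ?case by (simp add: algebra_simps)
  qed simp
  have "real k * (real n * long_term_advantage V f \<epsilon>) \<le> real k * (real n * b) + K" for k
    using le[OF p, of k] K[of "k * n"] by (simp add: abs_le_iff)
  then have "real n * long_term_advantage V f \<epsilon> \<le> real n * b"
    by (rule le_if_multiples_le)
  with n show ?thesis by simp
qed

text \<open>
  The maximum of \<open>u\<^sub>j - j a\<close> over \<open>j \<le> n\<close> is a subsolution as soon as \<open>u\<^sub>n - n a \<ge> u\<^sub>0\<close>.
\<close>

lemma subsolution_below_advantage:
  assumes e: "0 < \<epsilon>" and a: "a < long_term_advantage V f \<epsilon>"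
  obtains w where "continuous_on V w" "\<And>x. x \<in> V \<Longrightarrow> w x + a \<le> game_step V \<epsilon> f w x"
proof -
  let ?u = "game_value V \<epsilon> f (\<lambda>_. 0)" and ?c = "long_term_advantage V f \<epsilon>"
  obtain K where K: "\<And>n x. x \<in> V \<Longrightarrow> \<bar>?u n x - real n * ?c\<bar> \<le> K"
    using long_term_advantage_bounded[OF e, of "\<lambda>_. 0"] by (metis continuous_on_const)
  \<comment> \<open>With this \<open>n\<close>, \<open>?u n x - n * a\<close> is at least
    \<open>n * (?c - a) - K > 0\<close>, the terminal payoff.\<close>
  obtain n where n: "K < real n * (?c - a)"
    using reals_Archimedean3[of "?c - a"] a by auto
  have cont: "continuous_on V (?u j)" for j
    using e by (intro continuous_game_value) auto
  have "\<exists>w. continuous_on V w \<and> (\<forall>j\<le>m. \<forall>x\<in>V. ?u j x - real j * a \<le> w x) \<and>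
      (\<forall>x\<in>V. \<exists>j\<le>m. w x = ?u j x - real j * a)" for m
  proof (induction m)
    case 0
    show ?case using cont[of 0] by (intro exI[of _ "?u 0"]) auto
  next
    case (Suc m)
    then obtain w where w: "continuous_on V w" "\<And>j x. j \<le> m \<Longrightarrow> x \<in> V \<Longrightarrow> ?u j x - real j * a \<le> w x"
      "\<And>x. x \<in> V \<Longrightarrow> \<exists>j\<le>m. w x = ?u j x - real j * a" by blast
    let ?w = "\<lambda>x. max (w x) (?u (Suc m) x - real (Suc m) * a)"
    have "continuous_on V ?w"
      by (intro continuous_intros w cont)
    moreover have "?u j x - real j * a \<le> ?w x" if "j \<le> Suc m" "x \<in> V" for j x
      using w(2)[of j x] that by (auto simp: le_Suc_eq le_max_iff_disj)
    moreover have "\<exists>j\<le>Suc m. ?w x = ?u j x - real j * a" if "x \<in> V" for x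
      using w(3)[OF that] by (metis le_Suc_eq max_def)
    ultimately show ?case by blast
  qed
  then obtain w where w: "continuous_on V w"
    "\<And>j x. j \<le> n \<Longrightarrow> x \<in> V \<Longrightarrow> ?u j x - real j * a \<le> w x"
    "\<And>x. x \<in> V \<Longrightarrow> \<exists>j\<le>n. w x = ?u j x - real j * a" by meson
  have "w x + a \<le> game_step V \<epsilon> f w x" if x: "x \<in> V" for x
  proof -
    \<comment> \<open>One round maps the candidate with index \<open>j\<close> to the one with index
      \<open>Suc j\<close>, raised by \<open>a\<close>, and \<open>w\<close> dominates candidate
      \<open>j\<close>.\<close>
    have *: "?u (Suc j) x - real (Suc j) * a + a \<le> game_step V \<epsilon> f w x" if "j \<le> n" for j
      using game_step_mono[OF cont w(1) x, where \<epsilon> = \<epsilon> and a = "real j * a" and f = f] w(2) that e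
      unfolding game_value_Suc by (force simp: algebra_simps)
    obtain j where j: "j \<le> n" "w x = ?u j x - real j * a"
      using w(3)[OF x] by blast
    show ?thesis
    proof (cases j)
      \<comment> \<open>Index 0 has no predecessor, but there candidate \<open>n\<close> is at least
        as large. Here \<open>n \<noteq> 0\<close>, since \<open>K\<close> is nonnegative by its
        instance at time 0.\<close>
      case 0
      then have "w x \<le> ?u n x - real n * a"
        using j K[OF x, of n] n by (simp add: algebra_simps abs_le_iff)
      moreover have "n \<noteq> 0"
        using n K[OF x, of 0] by (cases n) auto
      ultimately show ?thesis
        using *[of "n - 1"] by simp
    next
      case (Suc i)
      with *[of i] j show ?thesis by simp
    qed
  qed
  with w(1) that show thesis by blast
qed

section \<open>Continuity in the radius\<close>

text \<open>In each round, half of \<open>\<theta>\<close> pays for the earlier rounds by induction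
  and half for the change of radius, by uniform continuity of the value at radius
  \<open>\<epsilon>\<close>.\<close>

lemma game_value_radius_continuous:
  assumes e: "0 \<le> \<epsilon>" and u: "continuous_on V u" and "0 < \<theta>"
  shows "\<exists>\<rho>>0. \<forall>\<epsilon>'\<ge>0. \<bar>\<epsilon>' - \<epsilon>\<bar> < \<rho> \<longrightarrow>
    (\<forall>x\<in>V. game_value V \<epsilon>' f u n x \<le> game_value V \<epsilon> f u n x + \<theta>)"
  using \<open>0 < \<theta>\<close>
proof (induction n arbitrary: \<theta>)
  case 0
  then show ?case by (intro exI[of _ 1]) auto
next
  case (Suc n)
  let ?v = "game_value V \<epsilon> f u n"
  have v: "continuous_on V ?v" by (rule continuous_game_value[OF u e])
  obtain \<rho>1 where \<rho>1: "\<rho>1 > 0" "\<And>\<epsilon>' x. 0 \<le> \<epsilon>' \<Longrightarrow> \<bar>\<epsilon>' - \<epsilon>\<bar> < \<rho>1 \<Longrightarrow> x \<in> V \<Longrightarrow>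
      game_value V \<epsilon>' f u n x \<le> ?v x + \<theta> / 2"
    using Suc.IH[of "\<theta> / 2"] Suc.prems by auto
  obtain \<rho>2 where \<rho>2: "\<rho>2 > 0" "\<And>y z. y \<in> V \<Longrightarrow> z \<in> V \<Longrightarrow> dist y z < \<rho>2 \<Longrightarrow> \<bar>?v y - ?v z\<bar> < \<theta> / 2"
    using compact_uniformly_continuous[OF v compact_V] Suc.prems
    unfolding uniformly_continuous_on_def dist_real_def
    by (metis dist_commute half_gt_zero)
  have "game_value V \<epsilon>' f u (Suc n) x \<le> game_value V \<epsilon> f u (Suc n) x + \<theta>"
    if "0 \<le> \<epsilon>'" "\<bar>\<epsilon>' - \<epsilon>\<bar> < min \<rho>1 \<rho>2" "x \<in> V" for \<epsilon>' x
    unfolding game_value_Suc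
  proof (rule game_step_diff_le[OF _ v])
    fix y z assume yz: "y \<in> V" "z \<in> V" "dist y z \<le> \<bar>\<epsilon>' - \<epsilon>\<bar>"
    then have "\<bar>?v y - ?v z\<bar> < \<theta> / 2" using that by (intro \<rho>2) auto
    moreover have "game_value V \<epsilon>' f u n y \<le> ?v y + \<theta> / 2"
      using that yz by (intro \<rho>1) auto
    ultimately show "game_value V \<epsilon>' f u n y \<le> ?v z + \<theta>" by argo
  qed (use that e u continuous_game_value in auto)
  then show ?case
    using \<rho>1(1) \<rho>2(1) by (intro exI[of _ "min \<rho>1 \<rho>2"]) auto
qed

text \<open>At a fixed time \<open>n\<close> so late that
  \<open>K + \<theta> / 2 \<le> n * \<theta>\<close>, nearby radii change the value by at most
  \<open>\<theta> / 2\<close>, so it stays below \<open>n * (?c + \<theta>)\<close> and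
  \<open>advantage_le\<close> applies.\<close>

lemma long_term_advantage_usc:
  assumes e: "0 < \<epsilon>" and "0 < \<theta>"
  obtains \<rho> where "\<rho> > 0" "\<And>\<epsilon>'. 0 < \<epsilon>' \<Longrightarrow> \<bar>\<epsilon>' - \<epsilon>\<bar> < \<rho> \<Longrightarrow>
    long_term_advantage V f \<epsilon>' \<le> long_term_advantage V f \<epsilon> + \<theta>"
proof -
  let ?u = "game_value V \<epsilon> f (\<lambda>_. 0)" and ?c = "long_term_advantage V f \<epsilon>"
  have t: "0 < \<theta> / 2" using \<open>0 < \<theta>\<close> by simp
  obtain K where K: "\<And>n x. x \<in> V \<Longrightarrow> \<bar>?u n x - real n * ?c\<bar> \<le> K"
    using long_term_advantage_bounded[OF e, of "\<lambda>_. 0"] by (metis continuous_on_const)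
  obtain m where m: "K < real m * (\<theta> / 2)"
    using reals_Archimedean3[OF t] by blast
  define n where "n = Suc m"
  have n: "K + \<theta> / 2 \<le> real n * \<theta>"
  proof -
    have "real n * \<theta> = real m * (\<theta> / 2) + \<theta> / 2 + real n * \<theta> / 2"
      by (simp add: n_def field_simps)
    moreover have "0 \<le> real n * \<theta> / 2" using t by simp
    ultimately show ?thesis using m by linarith
  qed
  obtain \<rho> where \<rho>: "\<rho> > 0" "\<And>\<epsilon>' x. 0 \<le> \<epsilon>' \<Longrightarrow> \<bar>\<epsilon>' - \<epsilon>\<bar> < \<rho> \<Longrightarrow> x \<in> V \<Longrightarrow>
      game_value V \<epsilon>' f (\<lambda>_. 0) n x \<le> ?u n x + \<theta> / 2"
    using game_value_radius_continuous[of \<epsilon> "\<lambda>_. 0" "\<theta> / 2" n] e t by auto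
  have "long_term_advantage V f \<epsilon>' \<le> ?c + \<theta>" if "0 < \<epsilon>'" "\<bar>\<epsilon>' - \<epsilon>\<bar> < \<rho>" for \<epsilon>'
  proof (rule advantage_le[OF that(1)])
    show "0 < n" by (simp add: n_def)
    fix x assume x: "x \<in> V"
    show "game_value V \<epsilon>' f (\<lambda>_. 0) n x \<le> real n * (?c + \<theta>)"
      using \<rho>(2)[of \<epsilon>' x] K[OF x, of n] n that x by (simp add: distrib_left abs_le_iff)
  qed
  with \<rho>(1) that show thesis by blast
qed

section \<open>From a radius to its multiples\<close>

text \<open>
  If \<open>u\<close> is a subsolution at radius \<open>\<epsilon>\<close>, then \<open>j \<mapsto> max\<^bsub>B(x,j\<epsilon>)\<^esub> u\<close>, extended by
  \<open>min\<^bsub>B(x,\<epsilon>)\<^esub> u\<close> to \<open>j = -1\<close>, is convex up to the running payoff. Its second difference of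
  step \<open>k\<close> bounds the one of \<open>x \<mapsto> max\<^bsub>B(x,(k-1)\<epsilon>)\<^esub> u\<close> at radius \<open>k\<epsilon>\<close>.
\<close>

lemma sup_convolution_subsolution:
  assumes e: "0 < \<epsilon>" and k: "0 < k" and u: "continuous_on V u"
    and sub: "\<And>x. x \<in> V \<Longrightarrow> u x + a \<le> game_step V \<epsilon> f u x"
    and \<omega>: "\<And>x y. x \<in> V \<Longrightarrow> y \<in> V \<Longrightarrow> dist x y \<le> 2 * (real k * \<epsilon>) \<Longrightarrow> f y \<le> f x + \<omega>"
    and x: "x \<in> V"
  defines "w \<equiv> \<lambda>x. ball_sup V (real (k - 1) * \<epsilon>) u x / (real k)\<^sup>2"
  shows "w x + (a - \<omega>) \<le> game_step V (real k * \<epsilon>) f w x"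
proof -
  \<comment> \<open>Indices are shifted by one: \<open>M (Suc i)\<close> belongs to radius
    \<open>i * \<epsilon>\<close>, and \<open>M 0\<close> takes the place of index -1.\<close>
  define M where "M j = (case j of 0 \<Rightarrow> ball_inf V \<epsilon> u x | Suc i \<Rightarrow> ball_sup V (real i * \<epsilon>) u x)" for j
  have M_ge: "u y \<le> M (Suc j)" if "y \<in> V" "dist x y \<le> real j * \<epsilon>" for y j
    using ball_sup_upper[OF u x that] by (simp add: M_def)
  \<comment> \<open>The subsolution inequality is used at a maximizer \<open>y\<close> for radius
    \<open>j * \<epsilon>\<close>. For \<open>j = 0\<close> this is \<open>x\<close> itself;
    otherwise \<open>B(y,\<epsilon>)\<close> meets the ball of radius
    \<open>(j - 1) * \<epsilon>\<close> about \<open>x\<close>.\<close>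
  have convex: "2 * M (Suc j) - M j - 2 * (f x + \<omega> - a) \<le> M (Suc (Suc j))" if j: "j + 2 \<le> 2 * k" for j
  proof -
    obtain y where y: "y \<in> V" "dist x y \<le> real j * \<epsilon>" "M (Suc j) = u y"
      using ball_sup_attained[OF u x, of "real j * \<epsilon>"] e by (auto simp: M_def)
    have "ball_inf V \<epsilon> u y \<le> M j"
    proof (cases j)
      case 0
      then show ?thesis using y by (simp add: M_def)
    next
      case (Suc i)
      obtain z where z: "z \<in> V" "dist x z \<le> real i * \<epsilon>" "dist z y \<le> \<epsilon>"
        using length_space_split[OF V x y(1), of "real i * \<epsilon>" \<epsilon>] y(2) e by (auto simp: Suc algebra_simps)
      then show ?thesis
        using M_ge[of z i] ball_inf_lower[OF u y(1), of z \<epsilon>] by (simp add: Suc dist_commute)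
    qed
    moreover have "ball_sup V \<epsilon> u y \<le> M (Suc (Suc j))"
    proof -
      obtain z where z: "z \<in> V" "dist y z \<le> \<epsilon>" "ball_sup V \<epsilon> u y = u z"
        using ball_sup_attained[OF u y(1), of \<epsilon>] e by auto
      have "dist x z \<le> real (Suc j) * \<epsilon>"
        using dist_triangle[of x z y] z y by (simp add: algebra_simps)
      with M_ge[of z "Suc j"] z show ?thesis by simp
    qed
    moreover have "real j * \<epsilon> \<le> 2 * (real k * \<epsilon>)"
      using j e by (simp flip: mult.assoc add: mult_right_mono)
    then have "f y \<le> f x + \<omega>"
      using \<omega>[OF x y(1)] y(2) by simp
    ultimately show ?thesis
      using sub[OF y(1)] y(3) unfolding game_step_def by argo
  qed
  \<comment> \<open>The defect grows like \<open>k\<^sup>2\<close>, which is why \<open>w\<close> is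
    normalized by \<open>k\<^sup>2\<close>: the payoff \<open>f x\<close> then enters with factor
    1.\<close>
  have defect: "2 * M k - (real k)\<^sup>2 * (2 * (f x + \<omega> - a)) \<le> M (2 * k) + M 0"
    by (rule discrete_convexity_defect) (rule convex)
  have wM: "w x = M k / (real k)\<^sup>2"
    using k by (cases k) (auto simp: w_def M_def)
  have w: "continuous_on V w"
    unfolding w_def using k e by (intro continuous_intros continuous_ball_sup u) auto
  have k2: "0 < (real k)\<^sup>2" using k by simp
  \<comment> \<open>The maximizer for radius \<open>(2 * k - 1) * \<epsilon> = k * \<epsilon> + (k -
    1) * \<epsilon>\<close> is seen by \<open>w\<close> from a point within
    \<open>k * \<epsilon>\<close> of \<open>x\<close>.\<close>
  have far: "\<exists>y\<in>V. dist x y \<le> real k * \<epsilon> \<and> M (2 * k) / (real k)\<^sup>2 \<le> w y"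
  proof -
    have "M (2 * k) = ball_sup V (real (2 * k - 1) * \<epsilon>) u x"
      unfolding M_def using k
      by (metis One_nat_def Suc_pred nat.case(2) nat_0_less_mult_iff zero_less_numeral)
    then obtain z where z: "z \<in> V" "dist x z \<le> real (2 * k - 1) * \<epsilon>" "M (2 * k) = u z"
      using ball_sup_attained[OF u x, of "real (2 * k - 1) * \<epsilon>"] e by auto
    have "real (2 * k - 1) * \<epsilon> = real k * \<epsilon> + real (k - 1) * \<epsilon>"
      using k by (simp add: algebra_simps of_nat_diff)
    then obtain y where y: "y \<in> V" "dist x y \<le> real k * \<epsilon>" "dist y z \<le> real (k - 1) * \<epsilon>"
      using length_space_split[OF V x z(1), of "real k * \<epsilon>" "real (k - 1) * \<epsilon>"] z(2) e by auto
    then have "u z \<le> ball_sup V (real (k - 1) * \<epsilon>) u y"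
      using ball_sup_upper[OF u] z(1) by blast
    with y z(3) show ?thesis
      by (auto simp: w_def intro!: bexI[of _ y] divide_right_mono)
  qed
  \<comment> \<open>The ball of radius \<open>(k - 1) * \<epsilon>\<close> about \<open>z\<close>
    meets \<open>B(x,\<epsilon>)\<close>, where \<open>u\<close> is at least
    \<open>M 0\<close>.\<close>
  have near: "M 0 / (real k)\<^sup>2 \<le> w z" if z: "z \<in> V" "dist x z \<le> real k * \<epsilon>" for z
  proof -
    have "real k * \<epsilon> = \<epsilon> + real (k - 1) * \<epsilon>"
      using k by (simp add: algebra_simps of_nat_diff)
    then obtain y where y: "y \<in> V" "dist x y \<le> \<epsilon>" "dist y z \<le> real (k - 1) * \<epsilon>"
      using length_space_split[OF V x z(1), of \<epsilon> "real (k - 1) * \<epsilon>"] z(2) e by auto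
    then have "M 0 \<le> ball_sup V (real (k - 1) * \<epsilon>) u z"
      using ball_inf_lower[OF u x y(1,2)] ball_sup_upper[OF u z(1) y(1), of "real (k - 1) * \<epsilon>"]
      by (simp add: M_def dist_commute)
    then show ?thesis by (auto simp: w_def intro: divide_right_mono)
  qed
  obtain y where y: "y \<in> V" "dist x y \<le> real k * \<epsilon>" "M (2 * k) / (real k)\<^sup>2 \<le> w y"
    using far by blast
  have "(M 0 / (real k)\<^sup>2 + w y) / 2 + f x \<le> game_step V (real k * \<epsilon>) f w x"
    using game_step_ge[OF w x y(1,2) near] .
  moreover have "M k / (real k)\<^sup>2 - (f x + \<omega> - a) \<le> (M (2 * k) / (real k)\<^sup>2 + M 0 / (real k)\<^sup>2) / 2"
  proof -
    have "M k / (real k)\<^sup>2 - (f x + \<omega> - a) =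
        (2 * M k - (real k)\<^sup>2 * (2 * (f x + \<omega> - a))) / (2 * (real k)\<^sup>2)"
      using k2 by (simp add: field_simps)
    also have "\<dots> \<le> (M (2 * k) + M 0) / (2 * (real k)\<^sup>2)"
      using defect by (rule divide_right_mono) simp
    also have "\<dots> = (M (2 * k) / (real k)\<^sup>2 + M 0 / (real k)\<^sup>2) / 2"
      by (simp add: add_divide_distrib)
    finally show ?thesis .
  qed
  ultimately show ?thesis
    using y(3) unfolding wM by argo
qed

text \<open>Each \<open>a\<close> below the advantage at \<open>\<epsilon>\<close> has a
  subsolution, which transfers to radius \<open>k * \<epsilon>\<close> at the cost
  \<open>\<omega>\<close>.\<close>

lemma advantage_multiple_ge:
  assumes e: "0 < \<epsilon>" and k: "0 < k"
    and \<omega>: "\<And>x y. x \<in> V \<Longrightarrow> y \<in> V \<Longrightarrow> dist x y \<le> 2 * (real k * \<epsilon>) \<Longrightarrow> f y \<le> f x + \<omega>"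
  shows "long_term_advantage V f \<epsilon> \<le> long_term_advantage V f (real k * \<epsilon>) + \<omega>"
proof (rule dense_le)
  fix a assume "a < long_term_advantage V f \<epsilon>"
  then obtain u where u: "continuous_on V u" "\<And>x. x \<in> V \<Longrightarrow> u x + a \<le> game_step V \<epsilon> f u x"
    using subsolution_below_advantage[OF e] by blast
  let ?w = "\<lambda>x. ball_sup V (real (k - 1) * \<epsilon>) u x / (real k)\<^sup>2"
  have "continuous_on V ?w"
    using k e u by (intro continuous_intros continuous_ball_sup) auto
  then have "a - \<omega> \<le> long_term_advantage V f (real k * \<epsilon>)"
    using k e sup_convolution_subsolution[OF e k u \<omega>]
    by (intro subsolution_le_advantage[of _ ?w]) auto
  then show "a \<le> long_term_advantage V f (real k * \<epsilon>) + \<omega>" by simp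
qed

end

section \<open>Symmetry and comparison of small radii\<close>

lemma long_term_advantage_uminus:
  assumes f: "continuous_on V f" and e: "0 < \<epsilon>"
  shows "long_term_advantage V (\<lambda>x. - f x) \<epsilon> = - long_term_advantage V f \<epsilon>"
proof (rule long_term_advantage_eqI)
  show "continuous_on V (\<lambda>x. - f x)" using f by (rule continuous_on_minus)
  fix u0 :: "'a \<Rightarrow> real" assume "continuous_on V u0"
  then have "continuous_on V (\<lambda>x. - u0 x)" by (rule continuous_on_minus)
  then obtain K where K: "\<And>n x. x \<in> V \<Longrightarrow>
      \<bar>game_value V \<epsilon> f (\<lambda>x. - u0 x) n x - real n * long_term_advantage V f \<epsilon>\<bar> \<le> K"
    using long_term_advantage_bounded[OF f e] by metis
  have "\<bar>game_value V \<epsilon> (\<lambda>x. - f x) u0 n x - real n * - long_term_advantage V f \<epsilon>\<bar> \<le> K"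
    if "x \<in> V" for n x
    using K[OF that, of n] game_value_uminus[of V \<epsilon> f "\<lambda>x. - u0 x" n x] by simp
  then show "\<exists>K. \<forall>n. \<forall>x\<in>V.
      \<bar>game_value V \<epsilon> (\<lambda>x. - f x) u0 n x - real n * - long_term_advantage V f \<epsilon>\<bar> \<le> K"
    by blast
qed

text \<open>The one-sided inequality for \<open>f\<close> gives one bound, that for
  \<open>- f\<close> the other.\<close>

lemma advantage_multiple_near:
  assumes f: "continuous_on V f" and e: "0 < \<epsilon>" and k: "0 < k"
    and \<omega>: "\<And>x y. x \<in> V \<Longrightarrow> y \<in> V \<Longrightarrow> dist x y \<le> 2 * (real k * \<epsilon>) \<Longrightarrow> \<bar>f x - f y\<bar> \<le> \<omega>"
  shows "\<bar>long_term_advantage V f (real k * \<epsilon>) - long_term_advantage V f \<epsilon>\<bar> \<le> \<omega>"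
proof -
  have f': "continuous_on V (\<lambda>x. - f x)" using f by (rule continuous_on_minus)
  have ke: "0 < real k * \<epsilon>" using k e by simp
  have "f y \<le> f x + \<omega>" "- f y \<le> - f x + \<omega>"
    if "x \<in> V" "y \<in> V" "dist x y \<le> 2 * (real k * \<epsilon>)" for x y
    using \<omega>[OF that] by auto
  from advantage_multiple_ge[OF f e k this(1)] advantage_multiple_ge[OF f' e k this(2)]
  show ?thesis
    by (simp add: long_term_advantage_uminus[OF f e] long_term_advantage_uminus[OF f ke])
qed

lemma long_term_advantage_continuous:
  assumes f: "continuous_on V f" and e: "0 < \<epsilon>" and t: "0 < \<theta>"
  obtains \<rho> where "\<rho> > 0" "\<And>\<epsilon>'. 0 < \<epsilon>' \<Longrightarrow> \<bar>\<epsilon>' - \<epsilon>\<bar> < \<rho> \<Longrightarrow>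
    \<bar>long_term_advantage V f \<epsilon>' - long_term_advantage V f \<epsilon>\<bar> \<le> \<theta>"
proof -
  have f': "continuous_on V (\<lambda>x. - f x)" using f by (rule continuous_on_minus)
  obtain \<rho>1 where \<rho>1: "\<rho>1 > 0" "\<And>\<epsilon>'. 0 < \<epsilon>' \<Longrightarrow> \<bar>\<epsilon>' - \<epsilon>\<bar> < \<rho>1 \<Longrightarrow>
      long_term_advantage V f \<epsilon>' \<le> long_term_advantage V f \<epsilon> + \<theta>"
    using long_term_advantage_usc[OF f e t] by blast
  obtain \<rho>2 where \<rho>2: "\<rho>2 > 0" "\<And>\<epsilon>'. 0 < \<epsilon>' \<Longrightarrow> \<bar>\<epsilon>' - \<epsilon>\<bar> < \<rho>2 \<Longrightarrow>
      long_term_advantage V (\<lambda>x. - f x) \<epsilon>' \<le> long_term_advantage V (\<lambda>x. - f x) \<epsilon> + \<theta>"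
    using long_term_advantage_usc[OF f' e t] by blast
  have "\<bar>long_term_advantage V f \<epsilon>' - long_term_advantage V f \<epsilon>\<bar> \<le> \<theta>"
    if "0 < \<epsilon>'" "\<bar>\<epsilon>' - \<epsilon>\<bar> < min \<rho>1 \<rho>2" for \<epsilon>'
    using \<rho>1(2)[of \<epsilon>'] \<rho>2(2)[of \<epsilon>'] that
    by (simp add: long_term_advantage_uminus[OF f e] long_term_advantage_uminus[OF f that(1)])
  with \<rho>1(1) \<rho>2(1) that[of "min \<rho>1 \<rho>2"] show thesis by simp
qed

text \<open>
  Radii with a rational ratio are multiples of a common radius; continuity extends the comparison
  to all pairs of radii.
\<close>

lemma advantages_near:
  assumes f: "continuous_on V f" and e: "0 < \<epsilon>" and e': "0 < \<epsilon>'" and r: "\<epsilon> < r" "\<epsilon>' < r"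
    and \<omega>: "\<And>x y. x \<in> V \<Longrightarrow> y \<in> V \<Longrightarrow> dist x y \<le> 2 * r \<Longrightarrow> \<bar>f x - f y\<bar> \<le> \<omega>"
  shows "\<bar>long_term_advantage V f \<epsilon> - long_term_advantage V f \<epsilon>'\<bar> \<le> 2 * \<omega>"
proof (rule field_le_epsilon)
  fix \<theta> :: real assume "0 < \<theta>"
  then obtain \<rho> where \<rho>: "\<rho> > 0" "\<And>s. 0 < s \<Longrightarrow> \<bar>s - \<epsilon>'\<bar> < \<rho> \<Longrightarrow>
      \<bar>long_term_advantage V f s - long_term_advantage V f \<epsilon>'\<bar> \<le> \<theta>"
    using long_term_advantage_continuous[OF f e'] by metis
  \<comment> \<open>A rational \<open>q\<close> just above \<open>\<epsilon>' / \<epsilon>\<close>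
    keeps \<open>q * \<epsilon>\<close> below \<open>r\<close> and within \<open>\<rho>\<close> of
    \<open>\<epsilon>'\<close>.\<close>
  have "\<epsilon>' / \<epsilon> < min r (\<epsilon>' + \<rho>) / \<epsilon>"
    using e r \<rho>(1) by (simp add: divide_strict_right_mono)
  then obtain q where q: "q \<in> \<rat>" "\<epsilon>' / \<epsilon> < q" "q < min r (\<epsilon>' + \<rho>) / \<epsilon>"
    using Rats_dense_in_real by blast
  have "0 < q" using q(2) e e' by (meson divide_pos_pos less_trans)
  obtain i j :: nat where ij: "j \<noteq> 0" "\<bar>q\<bar> = real i / real j"
    using Rats_abs_nat_div_natE[OF q(1)] by metis
  have qij: "q = real i / real j" using ij \<open>0 < q\<close> by simp
  have i: "0 < i" and j: "0 < j" using qij \<open>0 < q\<close> ij(1) by (auto intro: gr0I)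
  define d where "d = \<epsilon> / real j"
  have d: "0 < d" "\<epsilon> = real j * d" "q * \<epsilon> = real i * d"
    using e j by (auto simp: d_def qij)
  have qe: "\<epsilon>' < q * \<epsilon>" "q * \<epsilon> < min r (\<epsilon>' + \<rho>)"
    using q(2,3) e by (auto simp: field_simps)
  \<comment> \<open>Both \<open>\<epsilon>\<close> and \<open>q * \<epsilon>\<close> are compared
    with the common divisor \<open>d\<close>, each at the cost \<open>\<omega>\<close>.\<close>
  have near: "\<bar>long_term_advantage V f (real k * d) - long_term_advantage V f d\<bar> \<le> \<omega>"
    if "0 < k" "real k * d < r" for k
    using advantage_multiple_near[OF f d(1) that(1) \<omega>] that(2) by simp
  have "\<bar>long_term_advantage V f \<epsilon> - long_term_advantage V f d\<bar> \<le> \<omega>"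
    using near[OF j] d r by simp
  moreover have "\<bar>long_term_advantage V f (q * \<epsilon>) - long_term_advantage V f d\<bar> \<le> \<omega>"
    using near[OF i] qe unfolding d(3) by simp
  moreover have "\<bar>long_term_advantage V f (q * \<epsilon>) - long_term_advantage V f \<epsilon>'\<bar> \<le> \<theta>"
    using \<rho>(2)[of "q * \<epsilon>"] qe e' by simp
  ultimately show "\<bar>long_term_advantage V f \<epsilon> - long_term_advantage V f \<epsilon>'\<bar> \<le> 2 * \<omega> + \<theta>"
    by linarith
qed

end

section \<open>Convergence as the radius tends to zero\<close>

theorem theorem1p9:
  fixes V :: "'a::metric_space set" and f :: "'a \<Rightarrow> real"
  assumes "compact_length_space V" and "V \<noteq> {}"
    and "continuous_on V f"
  shows "\<exists>L::real. ((\<lambda>\<epsilon>. long_term_advantage V f \<epsilon>) \<longlongrightarrow> L) (at_right 0)"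
proof -
  interpret game_space V by unfold_locales (use assms in auto)
  let ?c = "long_term_advantage V f"
  have near: "\<exists>r>0. \<forall>\<epsilon>>0. \<forall>\<epsilon>'>0. \<epsilon> < r \<longrightarrow> \<epsilon>' < r \<longrightarrow> \<bar>?c \<epsilon> - ?c \<epsilon>'\<bar> < e"
    if "e > 0" for e
  proof -
    obtain \<delta> where \<delta>: "\<delta> > 0"
      "\<And>x y. x \<in> V \<Longrightarrow> y \<in> V \<Longrightarrow> dist x y < \<delta> \<Longrightarrow> \<bar>f x - f y\<bar> < e / 3"
      using compact_uniformly_continuous[OF assms(3) compact_V] \<open>e > 0\<close>
      unfolding uniformly_continuous_on_def dist_real_def
      by (metis dist_commute divide_pos_pos zero_less_numeral)
    \<comment> \<open>With \<open>r = \<delta> / 4\<close>, points at distance at most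
      \<open>2 * r\<close> are closer than \<open>\<delta>\<close>; the third of \<open>e\<close>
      leaves \<open>2 * (e / 3) < e\<close>.\<close>
    have "\<bar>?c \<epsilon> - ?c \<epsilon>'\<bar> < e" if "0 < \<epsilon>" "0 < \<epsilon>'" "\<epsilon> < \<delta> / 4" "\<epsilon>' < \<delta> / 4" for \<epsilon> \<epsilon>'
    proof -
      have "\<bar>?c \<epsilon> - ?c \<epsilon>'\<bar> \<le> 2 * (e / 3)"
        using \<delta> by (intro advantages_near[OF assms(3) that] less_imp_le[OF \<delta>(2)]) auto
      with \<open>e > 0\<close> show ?thesis by linarith
    qed
    with \<delta>(1) show ?thesis by (intro exI[of _ "\<delta> / 4"]) auto
  qed
  \<comment> \<open>Completeness of the reals is applied along one sequence of radii;
    \<open>near\<close> carries its limit over to all small radii.\<close>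
  define X where "X n = ?c (inverse (real (Suc n)))" for n
  have small: "\<exists>N. \<forall>n\<ge>N. inverse (real (Suc n)) < r" if "r > 0" for r
    using LIMSEQ_inverse_real_of_nat that
    by (auto simp: lim_sequentially dest!: spec[of _ r])
  have "Cauchy X"
  proof (rule metric_CauchyI)
    fix e :: real assume "0 < e"
    then obtain r where r: "r > 0"
      "\<And>\<epsilon> \<epsilon>'. 0 < \<epsilon> \<Longrightarrow> 0 < \<epsilon>' \<Longrightarrow> \<epsilon> < r \<Longrightarrow> \<epsilon>' < r \<Longrightarrow> \<bar>?c \<epsilon> - ?c \<epsilon>'\<bar> < e"
      using near by meson
    obtain N where "\<And>n. n \<ge> N \<Longrightarrow> inverse (real (Suc n)) < r"
      using small[OF r(1)] by blast
    then show "\<exists>N. \<forall>m\<ge>N. \<forall>n\<ge>N. dist (X m) (X n) < e"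
      unfolding X_def dist_real_def using r(2) by (intro exI[of _ N]) auto
  qed
  then obtain L where L: "X \<longlonglongrightarrow> L"
    using Cauchy_convergent convergent_def by blast
  have "(?c \<longlongrightarrow> L) (at_right 0)"
  proof (rule tendstoI)
    fix e :: real assume "0 < e"
    then obtain r where r: "r > 0"
      "\<And>\<epsilon> \<epsilon>'. 0 < \<epsilon> \<Longrightarrow> 0 < \<epsilon>' \<Longrightarrow> \<epsilon> < r \<Longrightarrow> \<epsilon>' < r \<Longrightarrow> \<bar>?c \<epsilon> - ?c \<epsilon>'\<bar> < e / 2"
      using near[of "e / 2"] by (metis half_gt_zero)
    obtain N1 where N1: "\<And>n. n \<ge> N1 \<Longrightarrow> inverse (real (Suc n)) < r"
      using small[OF r(1)] by blast
    obtain N2 where N2: "\<And>n. n \<ge> N2 \<Longrightarrow> dist (X n) L < e / 2"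
      using L \<open>0 < e\<close> unfolding lim_sequentially by (meson half_gt_zero)
    have "dist (?c \<epsilon>) L < e" if "0 < \<epsilon>" "\<epsilon> < r" for \<epsilon>
    proof (rule dist_triangle_half_r)
      let ?n = "max N1 N2"
      show "dist (X ?n) (?c \<epsilon>) < e / 2"
        unfolding X_def dist_real_def using that N1[of ?n] by (intro r(2)) auto
      show "dist (X ?n) L < e / 2" by (rule N2) simp
    qed
    then show "\<forall>\<^sub>F \<epsilon> in at_right 0. dist (?c \<epsilon>) L < e"
      using r(1) by (auto simp: eventually_at_right_field)
  qed
  then show ?thesis ..
qed

end
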